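(* There exists a generalized ellipsoid of degree $16$ in $\mathbb{R}^9$ that is not SOCP-representable.
   Context: A set $\mathcal{E}_d\subset\mathbb{R}^n$ is a generalized ellipsoid of degree $d$ if it can be written as $\mathcal{E}_d=\{x\in\mathbb{R}^n\mid (x-x_0)^TP(t)(x-x_0)\le 1\ \ \forall t\in[-1,1]\}$ for some vector $x_0\in\mathbb{R}^n$ and some univariate polynomial matrix $P(t)$ (a real symmetric $n\times n$ matrix whose entries are polynomials in $t$) of degree at most $d$ that satisfies $P(t)\succeq 0$ for all $t\in[-1,1]$ and $\bigcap_{t\in[-1,1]}\mathrm{Ker}(P(t))=\{0\}$. For $n\ge 1$, the $n$-dimensional second-order cone is $L_n:=\left\{x\in\mathbb{R}^n\ \middle|\ \sqrt{\sum_{i=1}^{n-1}x_i^2}\le x_n\right\}$. A set $\Omega\subseteq\mathbb{R}^n$ is SOCP-representable if for some nonnegative integers $k,m$, a cone $K\subset\mathbb{R}^m$ which is a product of second-order cones, some matrices $A\in\mathbb{R}^{m\times n}$ and $B\in\mathbb{R}^{m\times k}$, and some vector $b\in\mathbb{R}^m$, one can write $\Omega=\{x\in\mathbb{R}^n\mid \exists u\in\mathbb{R}^k \text{ such that } Ax+Bu+b\in K\}$. *)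

theory Defs
  imports Complex_Main "Jordan_Normal_Form.Matrix_Kernel"
begin

text \<open>
  The dimensions \<open>m\<close> and \<open>k\<close> of an SOCP representation are existentially quantified, so \<open>\<real>\<^sup>n\<close> is
  rendered throughout as \<open>carrier_vec n\<close>, with coordinates numbered \<open>0, \<dots>, n - 1\<close>.
\<close>

definition psd_mat :: "nat \<Rightarrow> real mat \<Rightarrow> bool" where
  "psd_mat n A \<longleftrightarrow>
     A \<in> carrier_mat n n \<and> A\<^sup>T = A \<and> (\<forall>v \<in> carrier_vec n. v \<bullet> (A *\<^sub>v v) \<ge> 0)"

definition eval_mat :: "real poly mat \<Rightarrow> real \<Rightarrow> real mat" where
  "eval_mat P t = map_mat (\<lambda>p. poly p t) P"

definition poly_sym_mat :: "nat \<Rightarrow> nat \<Rightarrow> real poly mat \<Rightarrow> bool" where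
  "poly_sym_mat n d P \<longleftrightarrow>
     P \<in> carrier_mat n n \<and> P\<^sup>T = P \<and> (\<forall>i<n. \<forall>j<n. degree (P $$ (i, j)) \<le> d)"

definition generalized_ellipsoid :: "nat \<Rightarrow> nat \<Rightarrow> real vec set \<Rightarrow> bool" where
  "generalized_ellipsoid n d E \<longleftrightarrow>
     (\<exists>x0 P. x0 \<in> carrier_vec n \<and> poly_sym_mat n d P
        \<and> (\<forall>t\<in>{-1..1}. psd_mat n (eval_mat P t))
        \<and> (\<Inter>t\<in>{-1..1}. mat_kernel (eval_mat P t)) = {0\<^sub>v n}
        \<and> E = {x \<in> carrier_vec n.
                \<forall>t\<in>{-1..1}. (x - x0) \<bullet> (eval_mat P t *\<^sub>v (x - x0)) \<le> 1})"

text \<open>Meaningful for \<open>n \<ge> 1\<close> only; the last coordinate has index \<open>n - 1\<close>.\<close>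

definition second_order_cone :: "nat \<Rightarrow> real vec set" where
  "second_order_cone n =
     {x \<in> carrier_vec n. sqrt (\<Sum>i<n - 1. (x $ i)\<^sup>2) \<le> x $ (n - 1)}"

text \<open>
  \<open>soc_product [n\<^sub>1, \<dots>, n\<^sub>r]\<close> is the product of the cones of dimensions \<open>n\<^sub>1, \<dots>, n\<^sub>r\<close>, as a subset
  of \<open>\<real>\<^sup>m\<close> with \<open>m = n\<^sub>1 + \<dots> + n\<^sub>r\<close>; the empty product is \<open>\<real>\<^sup>0\<close>.
\<close>

fun soc_product :: "nat list \<Rightarrow> real vec set" where
  "soc_product [] = carrier_vec 0"
| "soc_product (n # ns) = {x @\<^sub>v y | x y. x \<in> second_order_cone n \<and> y \<in> soc_product ns}"

definition socp_representable :: "nat \<Rightarrow> real vec set \<Rightarrow> bool" where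
  "socp_representable n \<Omega> \<longleftrightarrow>
     (\<exists>k m ns A B b. (\<forall>l\<in>set ns. l \<ge> 1) \<and> sum_list ns = m
        \<and> A \<in> carrier_mat m n \<and> B \<in> carrier_mat m k \<and> b \<in> carrier_vec m
        \<and> \<Omega> = {x \<in> carrier_vec n.
                 \<exists>u \<in> carrier_vec k. A *\<^sub>v x + B *\<^sub>v u + b \<in> soc_product ns})"

end

theory Submission
  imports Defs "HOL-Analysis.L2_Norm"
begin

text \<open>
  The ellipsoid is the set of coefficient vectors of the polynomials of degree at most \<open>8\<close> that are
  bounded by \<open>1\<close> in absolute value on \<open>[-1, 1]\<close>: it is cut out by the rank-one quadratic forms
  \<open>(v(t) \<bullet> x)\<^sup>2 \<le> 1\<close>, where \<open>v(t) = (1, t, \<dots>, t\<^sup>8)\<close>, so that \<open>P(t) = v(t) v(t)\<^sup>T\<close> has degree \<open>16\<close>.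

  What obstructs a second-order cone representation is that the inequalities \<open>v(t) \<bullet> x \<le> 1\<close> can be
  made tight two at a time without any other becoming tight: for distinct \<open>a, b, c\<close> the polynomial
  \<open>1 - (t - a)\<^sup>2 (t - b)\<^sup>2 / 16\<close> belongs to the set, takes the value \<open>1\<close> at \<open>a\<close> and \<open>b\<close>, and is less
  than \<open>1\<close> at \<open>c\<close>. On the other hand, a face of a single second-order cone is \<open>{0}\<close>, a ray, or the
  whole cone, and among infinitely many such faces there are infinitely many for which the
  intersection of two lies in every third one: all of them are the whole cone, or all are the same
  face, or they are distinct and two of them meet only in \<open>0\<close>. This property passes to finite
  products of cones (\<open>soc_product_properties\<close>), by thinning out the infinite family once for each
  factor.

  The two facts contradict each other (\<open>not_socp_representable_if_neighborly\<close>). Given a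
  representation, let \<open>F t\<close> be the set of points of the product cone \<open>K\<close> that lie over the points
  with \<open>v(t) \<bullet> x = 1\<close>, and choose \<open>z t\<close> in its relative interior, so that the face of \<open>K\<close>
  generated by \<open>z t\<close> contains all of \<open>F t\<close>. Some \<open>y\<close> lies over the polynomial that is \<open>1\<close> at \<open>a\<close> and
  \<open>b\<close> but not at \<open>c\<close>. It is in the faces of \<open>z a\<close> and \<open>z b\<close>, so for suitable \<open>a, b, c\<close> it is in the
  face of \<open>z c\<close>, which means that the segment from \<open>y\<close> to \<open>z c\<close> can be prolonged beyond \<open>z c\<close> inside
  \<open>K\<close>. Along this segment \<open>v(c) \<bullet> x\<close> increases strictly up to \<open>1\<close> at \<open>z c\<close>, and so it exceeds \<open>1\<close>
  on the prolongation, which still lies over the ellipsoid. Arguing with faces of \<open>K\<close> avoids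
  dual certificates, whose existence would require a constraint qualification.
\<close>

section \<open>Faces of convex cones\<close>

definition convex_cone :: "nat \<Rightarrow> real vec set \<Rightarrow> bool" where
  "convex_cone N K \<longleftrightarrow> K \<subseteq> carrier_vec N \<and> (\<forall>x\<in>K. \<forall>y\<in>K. x + y \<in> K)
     \<and> (\<forall>x\<in>K. \<forall>c\<ge>0. c \<cdot>\<^sub>v x \<in> K)"

text \<open>
  For \<open>y\<close> and \<open>z\<close> in a convex cone \<open>K\<close> this says that \<open>y\<close> belongs to the smallest face of \<open>K\<close> that
  contains \<open>z\<close>.
\<close>
definition face_le :: "real vec set \<Rightarrow> real vec \<Rightarrow> real vec \<Rightarrow> bool" where
  "face_le K y z \<longleftrightarrow> (\<exists>e>0. z - e \<cdot>\<^sub>v y \<in> K)"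

text \<open>
  A form of convexity without a quantifier over weights: averaging two points is the way in which
  points of \<open>F\<close> with different merits are combined below.
\<close>
definition midpoint_closed :: "real vec set \<Rightarrow> bool" where
  "midpoint_closed F \<longleftrightarrow> (\<forall>x\<in>F. \<forall>y\<in>F. (1/2) \<cdot>\<^sub>v (x + y) \<in> F)"

text \<open>
  The point \<open>z\<close> plays the part of a relative interior point of \<open>F\<close>: the smallest face of \<open>K\<close>
  containing it contains \<open>F\<close>.
\<close>
definition has_generic_points :: "real vec set \<Rightarrow> bool" where
  "has_generic_points K \<longleftrightarrow>
     (\<forall>F \<subseteq> K. F \<noteq> {} \<longrightarrow> midpoint_closed F \<longrightarrow> (\<exists>z\<in>F. \<forall>y\<in>F. face_le K y z))"

text \<open>
  The combinatorial property that second-order cones have and larger semidefinite cones lack. It asks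
  for an infinite subfamily, not merely for three indices, because an infinite subfamily can be
  refined further when a second cone is to be treated.
\<close>
definition pairs_decide_faces :: "real vec set \<Rightarrow> bool" where
  "pairs_decide_faces K \<longleftrightarrow>
     (\<forall>(T :: real set) z. infinite T \<longrightarrow> z ` T \<subseteq> K \<longrightarrow>
        (\<exists>S\<subseteq>T. infinite S \<and>
           (\<forall>a\<in>S. \<forall>b\<in>S. \<forall>c\<in>S. a \<noteq> b \<longrightarrow>
              (\<forall>y\<in>K. face_le K y (z a) \<longrightarrow> face_le K y (z b) \<longrightarrow> face_le K y (z c)))))"

lemma convex_cone_carrier: "convex_cone N K \<Longrightarrow> x \<in> K \<Longrightarrow> x \<in> carrier_vec N"
  and convex_cone_add: "convex_cone N K \<Longrightarrow> x \<in> K \<Longrightarrow> y \<in> K \<Longrightarrow> x + y \<in> K"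
  and convex_cone_smult: "convex_cone N K \<Longrightarrow> x \<in> K \<Longrightarrow> 0 \<le> c \<Longrightarrow> c \<cdot>\<^sub>v x \<in> K"
  unfolding convex_cone_def by auto

lemma convex_cone_diff_smult_smaller:
  assumes K: "convex_cone N K" and z: "z \<in> K" and y: "y \<in> carrier_vec N"
    and zy: "z - e \<cdot>\<^sub>v y \<in> K" and d: "0 < d" "d \<le> e"
  shows "z - d \<cdot>\<^sub>v y \<in> K"
proof -
  have zc: "z \<in> carrier_vec N" using convex_cone_carrier[OF K z] .
  have "z - d \<cdot>\<^sub>v y = (1 - d/e) \<cdot>\<^sub>v z + (d/e) \<cdot>\<^sub>v (z - e \<cdot>\<^sub>v y)"
    using zc y d by (intro eq_vecI) (auto simp: field_simps)
  then show ?thesis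
    using convex_cone_add[OF K convex_cone_smult[OF K z, of "1 - d/e"] convex_cone_smult[OF K zy, of "d/e"]] d
    by simp
qed

lemma face_le_midpoint:
  assumes K: "convex_cone N K" and z: "z \<in> K" and w: "w \<in> K" and y: "y \<in> carrier_vec N"
    and le: "face_le K y z"
  shows "face_le K y ((1/2) \<cdot>\<^sub>v (z + w))"
proof -
  obtain e where e: "e > 0" "z - e \<cdot>\<^sub>v y \<in> K" using le unfolding face_le_def by blast
  have "(1/2) \<cdot>\<^sub>v (z + w) - (e/2) \<cdot>\<^sub>v y = (1/2) \<cdot>\<^sub>v ((z - e \<cdot>\<^sub>v y) + w)"
    using convex_cone_carrier[OF K z] convex_cone_carrier[OF K w] y
    by (intro eq_vecI) (auto simp: field_simps)
  moreover have "(1/2) \<cdot>\<^sub>v ((z - e \<cdot>\<^sub>v y) + w) \<in> K"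
    by (rule convex_cone_smult[OF K convex_cone_add[OF K e(2) w]]) simp
  ultimately show ?thesis unfolding face_le_def using e(1) by (intro exI[of _ "e/2"]) simp
qed

section \<open>Products of cones\<close>

definition cone_prod :: "real vec set \<Rightarrow> real vec set \<Rightarrow> real vec set" where
  "cone_prod K L = {x @\<^sub>v y | x y. x \<in> K \<and> y \<in> L}"

lemma append_diff_smult:
  assumes "z1 \<in> carrier_vec N" "y1 \<in> carrier_vec N" "z2 \<in> carrier_vec M" "y2 \<in> carrier_vec M"
  shows "(z1 @\<^sub>v z2) - (e::real) \<cdot>\<^sub>v (y1 @\<^sub>v y2) = (z1 - e \<cdot>\<^sub>v y1) @\<^sub>v (z2 - e \<cdot>\<^sub>v y2)"
  using assms by (intro eq_vecI) auto

lemma smult_append_add: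
  assumes "z1 \<in> carrier_vec N" "y1 \<in> carrier_vec N" "z2 \<in> carrier_vec M" "y2 \<in> carrier_vec M"
  shows "(e::real) \<cdot>\<^sub>v ((z1 @\<^sub>v z2) + (y1 @\<^sub>v y2)) = (e \<cdot>\<^sub>v (z1 + y1)) @\<^sub>v (e \<cdot>\<^sub>v (z2 + y2))"
  using assms by (intro eq_vecI) auto

lemma append_in_cone_prod_iff:
  assumes K: "convex_cone N K" and x: "x \<in> carrier_vec N"
  shows "x @\<^sub>v y \<in> cone_prod K L \<longleftrightarrow> x \<in> K \<and> y \<in> L"
proof
  assume "x @\<^sub>v y \<in> cone_prod K L"
  then obtain x' y' where s: "x @\<^sub>v y = x' @\<^sub>v y'" "x' \<in> K" "y' \<in> L"
    unfolding cone_prod_def by blast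
  then show "x \<in> K \<and> y \<in> L" using append_vec_eq[OF x convex_cone_carrier[OF K s(2)]] by simp
qed (auto simp: cone_prod_def)

lemma convex_cone_cone_prod:
  assumes K: "convex_cone N K" and L: "convex_cone M L"
  shows "convex_cone (N + M) (cone_prod K L)"
proof -
  have "cone_prod K L \<subseteq> carrier_vec (N + M)"
  proof
    fix v assume "v \<in> cone_prod K L"
    then obtain x y where "v = x @\<^sub>v y" "x \<in> K" "y \<in> L" unfolding cone_prod_def by blast
    then show "v \<in> carrier_vec (N + M)"
      using append_carrier_vec[OF convex_cone_carrier[OF K] convex_cone_carrier[OF L], of x y] by simp
  qed
  moreover have "x + y \<in> cone_prod K L" if xy: "x \<in> cone_prod K L" "y \<in> cone_prod K L" for x y
  proof -
    obtain x1 x2 y1 y2 where s: "x = x1 @\<^sub>v x2" "y = y1 @\<^sub>v y2"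
      "x1 \<in> K" "x2 \<in> L" "y1 \<in> K" "y2 \<in> L" using xy unfolding cone_prod_def by blast
    have "x + y = (x1 + y1) @\<^sub>v (x2 + y2)"
      using convex_cone_carrier[OF K s(3)] convex_cone_carrier[OF K s(5)]
        convex_cone_carrier[OF L s(4)] convex_cone_carrier[OF L s(6)]
      unfolding s(1,2) by (intro eq_vecI) auto
    then show ?thesis using convex_cone_add[OF K s(3,5)] convex_cone_add[OF L s(4,6)]
      unfolding cone_prod_def by blast
  qed
  moreover have "c \<cdot>\<^sub>v x \<in> cone_prod K L" if x: "x \<in> cone_prod K L" and c: "0 \<le> c" for x c
  proof -
    obtain x1 x2 where s: "x = x1 @\<^sub>v x2" "x1 \<in> K" "x2 \<in> L"
      using x unfolding cone_prod_def by blast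
    have "c \<cdot>\<^sub>v x = (c \<cdot>\<^sub>v x1) @\<^sub>v (c \<cdot>\<^sub>v x2)"
      using convex_cone_carrier[OF K s(2)] convex_cone_carrier[OF L s(3)]
      unfolding s(1) by (intro eq_vecI) auto
    then show ?thesis using convex_cone_smult[OF K s(2) c] convex_cone_smult[OF L s(3) c]
      unfolding cone_prod_def by blast
  qed
  ultimately show ?thesis unfolding convex_cone_def by blast
qed

text \<open>
  Faces of a product are products of faces. The two components come with different step lengths, and
  the smaller one works for both.
\<close>
lemma face_le_cone_prod_iff:
  assumes K: "convex_cone N K" and L: "convex_cone M L"
    and z: "z1 \<in> K" "z2 \<in> L" and y: "y1 \<in> K" "y2 \<in> L"
  shows "face_le (cone_prod K L) (y1 @\<^sub>v y2) (z1 @\<^sub>v z2) \<longleftrightarrow> face_le K y1 z1 \<and> face_le L y2 z2"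
proof -
  note c = convex_cone_carrier[OF K z(1)] convex_cone_carrier[OF K y(1)]
    convex_cone_carrier[OF L z(2)] convex_cone_carrier[OF L y(2)]
  have iff: "(z1 @\<^sub>v z2) - e \<cdot>\<^sub>v (y1 @\<^sub>v y2) \<in> cone_prod K L \<longleftrightarrow>
      z1 - e \<cdot>\<^sub>v y1 \<in> K \<and> z2 - e \<cdot>\<^sub>v y2 \<in> L" for e
    unfolding append_diff_smult[OF c] using c by (intro append_in_cone_prod_iff[OF K]) auto
  show ?thesis
  proof
    assume "face_le K y1 z1 \<and> face_le L y2 z2"
    then obtain e f where ef: "e > 0" "f > 0" "z1 - e \<cdot>\<^sub>v y1 \<in> K" "z2 - f \<cdot>\<^sub>v y2 \<in> L"
      unfolding face_le_def by blast
    have "z1 - min e f \<cdot>\<^sub>v y1 \<in> K"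
      by (rule convex_cone_diff_smult_smaller[OF K z(1) c(2) ef(3)]) (use ef in auto)
    moreover have "z2 - min e f \<cdot>\<^sub>v y2 \<in> L"
      by (rule convex_cone_diff_smult_smaller[OF L z(2) c(4) ef(4)]) (use ef in auto)
    ultimately show "face_le (cone_prod K L) (y1 @\<^sub>v y2) (z1 @\<^sub>v z2)"
      unfolding face_le_def iff using ef by (intro exI[of _ "min e f"]) auto
  next
    assume "face_le (cone_prod K L) (y1 @\<^sub>v y2) (z1 @\<^sub>v z2)"
    then show "face_le K y1 z1 \<and> face_le L y2 z2" unfolding face_le_def iff by blast
  qed
qed

text \<open>
  Generic points of the two projections of \<open>F\<close> need not belong to the same point of \<open>F\<close>, but the
  midpoint of a point that is generic in the first component and one that is generic in the second
  is generic in both, since passing to a midpoint only enlarges the generated face.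
\<close>
lemma has_generic_points_cone_prod:
  assumes K: "convex_cone N K" and L: "convex_cone M L"
    and gK: "has_generic_points K" and gL: "has_generic_points L"
  shows "has_generic_points (cone_prod K L)"
  unfolding has_generic_points_def
proof (intro allI impI)
  fix F assume F: "F \<subseteq> cone_prod K L" "F \<noteq> {}" "midpoint_closed F"
  have mid: "(1/2) \<cdot>\<^sub>v (x1 + y1) @\<^sub>v (1/2) \<cdot>\<^sub>v (x2 + y2) \<in> F"
    if "x1 \<in> K" "x2 \<in> L" "x1 @\<^sub>v x2 \<in> F" "y1 \<in> K" "y2 \<in> L" "y1 @\<^sub>v y2 \<in> F" for x1 x2 y1 y2
  proof -
    have "(1/2) \<cdot>\<^sub>v ((x1 @\<^sub>v x2) + (y1 @\<^sub>v y2)) \<in> F"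
      using F(3) that(3,6) unfolding midpoint_closed_def by blast
    then show ?thesis
      unfolding smult_append_add[OF convex_cone_carrier[OF K that(1)] convex_cone_carrier[OF K that(4)]
          convex_cone_carrier[OF L that(2)] convex_cone_carrier[OF L that(5)]] .
  qed
  define F1 where "F1 = {x \<in> K. \<exists>y\<in>L. x @\<^sub>v y \<in> F}"
  define F2 where "F2 = {y \<in> L. \<exists>x\<in>K. x @\<^sub>v y \<in> F}"
  have midK: "(1/2) \<cdot>\<^sub>v (x + y) \<in> K" if "x \<in> K" "y \<in> K" for x y
    by (rule convex_cone_smult[OF K convex_cone_add[OF K that]]) simp
  have midL: "(1/2) \<cdot>\<^sub>v (x + y) \<in> L" if "x \<in> L" "y \<in> L" for x y
    by (rule convex_cone_smult[OF L convex_cone_add[OF L that]]) simp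
  have "F1 \<noteq> {}" "F2 \<noteq> {}" using F(1,2) unfolding F1_def F2_def cone_prod_def by blast+
  moreover have "midpoint_closed F1"
    unfolding midpoint_closed_def
  proof (intro ballI)
    fix x y assume "x \<in> F1" "y \<in> F1"
    then obtain x2 y2 where s: "x \<in> K" "x2 \<in> L" "x @\<^sub>v x2 \<in> F" "y \<in> K" "y2 \<in> L" "y @\<^sub>v y2 \<in> F"
      unfolding F1_def by blast
    then show "(1/2) \<cdot>\<^sub>v (x + y) \<in> F1"
      using mid[OF s] midK[OF s(1,4)] midL[OF s(2,5)] unfolding F1_def by blast
  qed
  moreover have "midpoint_closed F2"
    unfolding midpoint_closed_def
  proof (intro ballI)
    fix x y assume "x \<in> F2" "y \<in> F2"
    then obtain x1 y1 where s: "x1 \<in> K" "x \<in> L" "x1 @\<^sub>v x \<in> F" "y1 \<in> K" "y \<in> L" "y1 @\<^sub>v y \<in> F"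
      unfolding F2_def by blast
    then show "(1/2) \<cdot>\<^sub>v (x + y) \<in> F2"
      using mid[OF s] midK[OF s(1,4)] midL[OF s(2,5)] unfolding F2_def by blast
  qed
  moreover have "F1 \<subseteq> K" "F2 \<subseteq> L" unfolding F1_def F2_def by auto
  ultimately obtain p1 q2 where p1: "p1 \<in> F1" "\<forall>y\<in>F1. face_le K y p1"
    and q2: "q2 \<in> F2" "\<forall>y\<in>F2. face_le L y q2"
    using gK gL unfolding has_generic_points_def by meson
  obtain p2 where p: "p1 \<in> K" "p2 \<in> L" "p1 @\<^sub>v p2 \<in> F" using p1(1) unfolding F1_def by blast
  obtain q1 where q: "q1 \<in> K" "q2 \<in> L" "q1 @\<^sub>v q2 \<in> F" using q2(1) unfolding F2_def by blast
  let ?z1 = "(1/2) \<cdot>\<^sub>v (p1 + q1)" and ?z2 = "(1/2) \<cdot>\<^sub>v (p2 + q2)"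
  have "face_le (cone_prod K L) y (?z1 @\<^sub>v ?z2)" if y: "y \<in> F" for y
  proof -
    obtain y1 y2 where s: "y = y1 @\<^sub>v y2" "y1 \<in> K" "y2 \<in> L"
      using F(1) y unfolding cone_prod_def by blast
    have y12: "y1 \<in> F1" "y2 \<in> F2" using s y unfolding F1_def F2_def by blast+
    have "face_le K y1 ?z1"
      using face_le_midpoint[OF K p(1) q(1) convex_cone_carrier[OF K s(2)]] p1(2) y12 by blast
    moreover have "face_le L y2 ((1/2) \<cdot>\<^sub>v (q2 + p2))"
      using face_le_midpoint[OF L q(2) p(2) convex_cone_carrier[OF L s(3)]] q2(2) y12 by blast
    moreover have "q2 + p2 = p2 + q2"
      using convex_cone_carrier[OF L q(2)] convex_cone_carrier[OF L p(2)] by (rule comm_add_vec)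
    ultimately have "face_le L y2 ?z2" by simp
    with \<open>face_le K y1 ?z1\<close> show ?thesis
      unfolding s(1) face_le_cone_prod_iff[OF K L midK[OF p(1) q(1)] midL[OF p(2) q(2)] s(2,3)] ..
  qed
  then show "\<exists>z\<in>F. \<forall>y\<in>F. face_le (cone_prod K L) y z"
    using mid[OF p q] by (intro bexI[of _ "?z1 @\<^sub>v ?z2"] ballI)
qed

lemma pairs_decide_faces_cone_prod:
  assumes K: "convex_cone N K" and L: "convex_cone M L"
    and pK: "pairs_decide_faces K" and pL: "pairs_decide_faces L"
  shows "pairs_decide_faces (cone_prod K L)"
  unfolding pairs_decide_faces_def
proof (intro allI impI)
  fix T :: "real set" and z :: "real \<Rightarrow> real vec"
  assume T: "infinite T" and z: "z ` T \<subseteq> cone_prod K L"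
  have "\<forall>t\<in>T. \<exists>p q. z t = p @\<^sub>v q \<and> p \<in> K \<and> q \<in> L"
    using z unfolding cone_prod_def by blast
  then obtain p q where pq: "\<forall>t\<in>T. z t = p t @\<^sub>v q t \<and> p t \<in> K \<and> q t \<in> L" by metis
  then have "p ` T \<subseteq> K" by auto
  with pK T obtain S1 where S1: "S1 \<subseteq> T" "infinite S1"
    "\<forall>a\<in>S1. \<forall>b\<in>S1. \<forall>c\<in>S1. a \<noteq> b \<longrightarrow>
       (\<forall>y\<in>K. face_le K y (p a) \<longrightarrow> face_le K y (p b) \<longrightarrow> face_le K y (p c))"
    unfolding pairs_decide_faces_def by meson
  have "q ` S1 \<subseteq> L" using pq S1(1) by auto
  with pL S1(2) obtain S where S: "S \<subseteq> S1" "infinite S"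
    "\<forall>a\<in>S. \<forall>b\<in>S. \<forall>c\<in>S. a \<noteq> b \<longrightarrow>
       (\<forall>y\<in>L. face_le L y (q a) \<longrightarrow> face_le L y (q b) \<longrightarrow> face_le L y (q c))"
    unfolding pairs_decide_faces_def by meson
  have "face_le (cone_prod K L) y (z c)"
    if abc: "a \<in> S" "b \<in> S" "c \<in> S" "a \<noteq> b" and y: "y \<in> cone_prod K L"
      and le: "face_le (cone_prod K L) y (z a)" "face_le (cone_prod K L) y (z b)" for a b c y
  proof -
    obtain y1 y2 where s: "y = y1 @\<^sub>v y2" "y1 \<in> K" "y2 \<in> L"
      using y unfolding cone_prod_def by blast
    have iff: "face_le (cone_prod K L) y (z t) \<longleftrightarrow> face_le K y1 (p t) \<and> face_le L y2 (q t)"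
      if "t \<in> S" for t
      using face_le_cone_prod_iff[OF K L _ _ s(2,3), of "p t" "q t"] that pq S(1) S1(1)
      unfolding s(1) by auto
    show ?thesis
      using le abc s(2,3) S(1) S(3) S1(3) unfolding iff[OF abc(1)] iff[OF abc(2)] iff[OF abc(3)]
      by (meson subsetD)
  qed
  then show "\<exists>S\<subseteq>T. infinite S \<and> (\<forall>a\<in>S. \<forall>b\<in>S. \<forall>c\<in>S. a \<noteq> b \<longrightarrow>
     (\<forall>y\<in>cone_prod K L. face_le (cone_prod K L) y (z a) \<longrightarrow>
        face_le (cone_prod K L) y (z b) \<longrightarrow> face_le (cone_prod K L) y (z c)))"
    using S(1,2) S1(1) by (intro exI[of _ S]) blast
qed

section \<open>The second-order cone\<close>

definition head_norm :: "nat \<Rightarrow> real vec \<Rightarrow> real" where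
  "head_norm n x = L2_set (\<lambda>i. x $ i) {..<n - 1}"

lemma soc_iff: "x \<in> second_order_cone n \<longleftrightarrow> x \<in> carrier_vec n \<and> head_norm n x \<le> x $ (n - 1)"
  unfolding second_order_cone_def head_norm_def L2_set_def by simp

lemma head_norm_nonneg: "0 \<le> head_norm n x"
  unfolding head_norm_def by simp

lemma head_norm_add:
  assumes "x \<in> carrier_vec n" "y \<in> carrier_vec n"
  shows "head_norm n (x + y) \<le> head_norm n x + head_norm n y"
proof -
  have "head_norm n (x + y) = L2_set (\<lambda>i. x $ i + y $ i) {..<n - 1}"
    unfolding head_norm_def using assms by (intro L2_set_cong) auto
  then show ?thesis unfolding head_norm_def using L2_set_triangle_ineq by metis
qed

lemma head_norm_smult:
  assumes "x \<in> carrier_vec n"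
  shows "head_norm n (c \<cdot>\<^sub>v x) = \<bar>c\<bar> * head_norm n x"
proof -
  have "head_norm n (c \<cdot>\<^sub>v x) = sqrt (\<Sum>i<n - 1. c\<^sup>2 * (x $ i)\<^sup>2)"
    unfolding head_norm_def L2_set_def using assms
    by (intro arg_cong[where f = sqrt] sum.cong) (auto simp: power_mult_distrib)
  also have "\<dots> = \<bar>c\<bar> * head_norm n x"
    unfolding head_norm_def L2_set_def sum_distrib_left[symmetric] by (simp add: real_sqrt_mult)
  finally show ?thesis .
qed

lemma convex_cone_soc:
  assumes n: "n \<ge> 1"
  shows "convex_cone n (second_order_cone n)"
  unfolding convex_cone_def
proof (intro conjI ballI allI impI)
  show "second_order_cone n \<subseteq> carrier_vec n" by (auto simp: soc_iff)
next
  fix x y assume "x \<in> second_order_cone n" "y \<in> second_order_cone n"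
  then show "x + y \<in> second_order_cone n"
    using head_norm_add[of x n y] n by (auto simp: soc_iff)
next
  fix x and c :: real assume "x \<in> second_order_cone n" "0 \<le> c"
  then show "c \<cdot>\<^sub>v x \<in> second_order_cone n"
    using n by (auto simp: soc_iff head_norm_smult mult_left_mono)
qed

lemma face_le_soc_interior:
  assumes n: "n \<ge> 1" and z: "z \<in> carrier_vec n" "head_norm n z < z $ (n - 1)"
    and y: "y \<in> carrier_vec n"
  shows "face_le (second_order_cone n) y z"
proof -
  define g where "g = z $ (n - 1) - head_norm n z"
  define h where "h = head_norm n y + \<bar>y $ (n - 1)\<bar> + 1"
  have gh: "g > 0" "h > 0" using z head_norm_nonneg[of n y] unfolding g_def h_def by auto
  have "head_norm n (z - (g/h) \<cdot>\<^sub>v y) = head_norm n (z + (- (g/h)) \<cdot>\<^sub>v y)"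
    using z y by (intro arg_cong[where f = "head_norm n"] eq_vecI) auto
  also have "\<dots> \<le> head_norm n z + (g/h) * head_norm n y"
    using head_norm_add[of z n "(- (g/h)) \<cdot>\<^sub>v y"] head_norm_smult[OF y, of "- (g/h)"] z y gh by auto
  also have "\<dots> \<le> z $ (n - 1) - (g/h) * y $ (n - 1)"
  proof -
    have "(g/h) * (head_norm n y + y $ (n - 1)) \<le> (g/h) * h"
      using gh by (intro mult_left_mono) (auto simp: h_def)
    then show ?thesis using gh by (simp add: g_def distrib_left)
  qed
  finally have "z - (g/h) \<cdot>\<^sub>v y \<in> second_order_cone n"
    using z y n by (auto simp: soc_iff)
  then show ?thesis unfolding face_le_def using gh by (intro exI[of _ "g/h"]) simp
qed

text \<open>
  The point at height \<open>1\<close> on the ray through \<open>z\<close>, a label for the ray. For \<open>z = 0\<close> the convention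
  \<open>1 / 0 = 0\<close> makes it the zero vector, so the label also covers the face \<open>{0}\<close>.
\<close>
definition direction :: "nat \<Rightarrow> real vec \<Rightarrow> real vec" where
  "direction n z = (1 / z $ (n - 1)) \<cdot>\<^sub>v z"

lemma soc_eq_zero:
  assumes "n \<ge> 1" "y \<in> second_order_cone n" "y $ (n - 1) = 0"
  shows "y = 0\<^sub>v n"
proof -
  have y: "y \<in> carrier_vec n" and "head_norm n y = 0"
    using assms head_norm_nonneg[of n y] by (auto simp: soc_iff)
  then have "\<forall>i<n - 1. y $ i = 0"
    unfolding head_norm_def by (subst (asm) L2_set_eq_0_iff) auto
  then have "y $ i = 0" if "i < n" for i
    using that assms(3) by (cases "i = n - 1") auto
  then show ?thesis using y by (intro eq_vecI) auto
qed

lemma soc_last_nonneg: "y \<in> second_order_cone n \<Longrightarrow> 0 \<le> y $ (n - 1)"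
  using head_norm_nonneg[of n y] by (auto simp: soc_iff)

text \<open>
  Half of the self-duality of the second-order cone, in the form that the reflected vector
  \<open>(-z', z\<^sub>n)\<close> of a vector \<open>z = (z', z\<^sub>n)\<close> of the cone pairs nonnegatively with the cone.
\<close>
lemma soc_pairing_nonneg:
  assumes "z \<in> second_order_cone n" "w \<in> second_order_cone n"
  shows "(\<Sum>i<n - 1. z $ i * w $ i) \<le> z $ (n - 1) * w $ (n - 1)"
proof -
  have "(\<Sum>i<n - 1. z $ i * w $ i) \<le> (\<Sum>i<n - 1. \<bar>z $ i\<bar> * \<bar>w $ i\<bar>)"
    by (intro sum_mono) (metis abs_ge_self abs_mult)
  also have "\<dots> \<le> head_norm n z * head_norm n w"
    unfolding head_norm_def by (rule L2_set_mult_ineq)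
  also have "\<dots> \<le> z $ (n - 1) * w $ (n - 1)"
    using assms head_norm_nonneg[of n w] head_norm_nonneg[of n z] by (intro mult_mono) (auto simp: soc_iff)
  finally show ?thesis .
qed

text \<open>
  A boundary point generates the face consisting of its own ray. For if \<open>z\<close> is a boundary point, the
  functional given by \<open>(-z', z\<^sub>n)\<close> is nonnegative on the cone and vanishes at \<open>z\<close>; if \<open>z\<close> is the sum
  of \<open>e y\<close> and another point of the cone, it therefore vanishes at \<open>y\<close>. This is the equality case of
  the Cauchy-Schwarz inequality for \<open>y'\<close> and \<open>z'\<close>, hence \<open>y\<close> is proportional to \<open>z\<close>.
\<close>
lemma face_le_soc_boundary_iff:
  assumes n: "n \<ge> 1" and z: "z \<in> carrier_vec n" "head_norm n z = z $ (n - 1)"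
    and y: "y \<in> second_order_cone n"
  shows "face_le (second_order_cone n) y z \<longleftrightarrow> y = y $ (n - 1) \<cdot>\<^sub>v direction n z"
proof
  let ?N = "n - 1"
  have zK: "z \<in> second_order_cone n" using z by (simp add: soc_iff)
  have yc: "y \<in> carrier_vec n" using y by (simp add: soc_iff)
  {
    assume "face_le (second_order_cone n) y z"
    then obtain e where e: "e > 0" and w: "z - e \<cdot>\<^sub>v y \<in> second_order_cone n"
      unfolding face_le_def by blast
    show "y = y $ ?N \<cdot>\<^sub>v direction n z"
    proof (cases "z $ ?N = 0")
      case True
      have "0 \<le> - (e * y $ ?N)" using soc_last_nonneg[OF w] True z yc n by auto
      then have "y $ ?N = 0" using e soc_last_nonneg[OF y]
        by (simp add: mult_le_0_iff)
      then show ?thesis using soc_eq_zero[OF n y] z by (auto simp: direction_def)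
    next
      case False
      have sq: "(head_norm n x)\<^sup>2 = (\<Sum>i<?N. (x $ i)\<^sup>2)" for x
        unfolding head_norm_def L2_set_def by (simp add: sum_nonneg)
      have zz: "(\<Sum>i<?N. (z $ i)\<^sup>2) = (z $ ?N)\<^sup>2" using sq[of z] z by simp
      have yy: "(\<Sum>i<?N. (y $ i)\<^sup>2) \<le> (y $ ?N)\<^sup>2"
        using sq[of y] power_mono[OF _ head_norm_nonneg[of n y], of "y $ ?N" 2] y
        by (simp add: soc_iff)
      define c where "c = (\<Sum>i<?N. z $ i * y $ i)"
      have "(\<Sum>i<?N. z $ i * (z - e \<cdot>\<^sub>v y) $ i) = (\<Sum>i<?N. (z $ i)\<^sup>2 - e * (z $ i * y $ i))"
        using z yc by (intro sum.cong) (auto simp: power2_eq_square algebra_simps)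
      also have "\<dots> = (z $ ?N)\<^sup>2 - e * c"
        unfolding c_def zz[symmetric] by (simp add: sum_subtractf sum_distrib_left)
      finally have "(z $ ?N)\<^sup>2 - e * c \<le> z $ ?N * (z $ ?N - e * y $ ?N)"
        using soc_pairing_nonneg[OF zK w] z yc n by auto
      then have "e * (z $ ?N * y $ ?N) \<le> e * c"
        by (simp add: power2_eq_square algebra_simps)
      then have ceq: "c = z $ ?N * y $ ?N"
        using e soc_pairing_nonneg[OF zK y] unfolding c_def[symmetric] by simp
      have "(\<Sum>i<?N. (z $ ?N * y $ i - y $ ?N * z $ i)\<^sup>2) =
          (\<Sum>i<?N. (z $ ?N)\<^sup>2 * (y $ i)\<^sup>2 - 2 * (z $ ?N * y $ ?N) * (z $ i * y $ i)
             + (y $ ?N)\<^sup>2 * (z $ i)\<^sup>2)"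
        by (intro sum.cong) (auto simp: power2_eq_square algebra_simps)
      also have "\<dots> = (z $ ?N)\<^sup>2 * (\<Sum>i<?N. (y $ i)\<^sup>2) - 2 * (z $ ?N * y $ ?N) * c
             + (y $ ?N)\<^sup>2 * (\<Sum>i<?N. (z $ i)\<^sup>2)"
        unfolding c_def by (simp add: sum.distrib sum_subtractf sum_distrib_left)
      also have "\<dots> = (z $ ?N)\<^sup>2 * ((\<Sum>i<?N. (y $ i)\<^sup>2) - (y $ ?N)\<^sup>2)"
        unfolding ceq zz by (simp add: power2_eq_square algebra_simps)
      also have "\<dots> \<le> 0" using yy by (simp add: mult_nonneg_nonpos)
      finally have "(\<Sum>i<?N. (z $ ?N * y $ i - y $ ?N * z $ i)\<^sup>2) = 0"
        by (meson antisym sum_nonneg zero_le_power2)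
      then have "\<forall>i<?N. z $ ?N * y $ i = y $ ?N * z $ i"
        by (subst (asm) sum_nonneg_eq_0_iff) auto
      then have "z $ ?N * y $ i = y $ ?N * z $ i" if "i < n" for i
        using that by (cases "i = ?N") auto
      then show ?thesis using False z yc
        by (intro eq_vecI) (auto simp: direction_def field_simps)
    qed
  next
    assume eq: "y = y $ ?N \<cdot>\<^sub>v direction n z"
    \<comment> \<open>The denominator is \<open>y\<^sub>n + 1\<close> rather than \<open>y\<^sub>n\<close>, which may vanish.\<close>
    define e where "e = (if z $ ?N = 0 then 1 else z $ ?N / (y $ ?N + 1))"
    have pos: "0 \<le> z $ ?N" "0 \<le> y $ ?N" using soc_last_nonneg zK y by auto
    have e: "e > 0" using pos unfolding e_def by auto
    have "z - e \<cdot>\<^sub>v y = (1 - e * (y $ ?N / z $ ?N)) \<cdot>\<^sub>v z"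
      by (subst eq, rule eq_vecI) (use z in \<open>auto simp: direction_def algebra_simps\<close>)
    moreover have "0 \<le> 1 - e * (y $ ?N / z $ ?N)"
      using pos by (auto simp: e_def)
    ultimately have "z - e \<cdot>\<^sub>v y \<in> second_order_cone n"
      using convex_cone_smult[OF convex_cone_soc[OF n] zK] by metis
    then show "face_le (second_order_cone n) y z" unfolding face_le_def using e by blast
  }
qed

text \<open>
  A point of \<open>F\<close> in the interior of the cone is generic. If there is none, all of \<open>F\<close> lies on one
  ray, since the midpoint of points on distinct rays would be interior; then any point of \<open>F\<close>
  other than \<open>0\<close> is generic, and so is \<open>0\<close> in case \<open>F = {0}\<close>.
\<close>
lemma has_generic_points_soc:
  assumes n: "n \<ge> 1"
  shows "has_generic_points (second_order_cone n)"
  unfolding has_generic_points_def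
proof (intro allI impI)
  let ?K = "second_order_cone n" and ?N = "n - 1"
  fix F assume F: "F \<subseteq> ?K" "F \<noteq> {}" "midpoint_closed F"
  show "\<exists>z\<in>F. \<forall>y\<in>F. face_le ?K y z"
  proof (cases "\<exists>z\<in>F. head_norm n z < z $ ?N")
    case True
    then show ?thesis using face_le_soc_interior[OF n] F(1) by (meson soc_iff subsetD)
  next
    case False
    then have bd: "x \<in> carrier_vec n \<and> head_norm n x = x $ ?N" if "x \<in> F" for x
      using F(1) that by (force simp: soc_iff)
    show ?thesis
    proof (cases "\<exists>z\<in>F. z $ ?N \<noteq> 0")
      case True
      then obtain z where z: "z \<in> F" "z $ ?N \<noteq> 0" by blast
      have zK: "z \<in> ?K" using z F(1) by auto
      have "face_le ?K y z" if y: "y \<in> F" for y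
      proof -
        define m where "m = (1/2) \<cdot>\<^sub>v (y + z)"
        have m: "m \<in> F" using F(3) y z unfolding m_def midpoint_closed_def by blast
        have yK: "y \<in> ?K" using y F(1) by auto
        have half: "(1/2) \<cdot>\<^sub>v z \<in> ?K" "(1/2) \<cdot>\<^sub>v y \<in> ?K"
          using convex_cone_smult[OF convex_cone_soc[OF n]] yK zK by auto
        have "m - (1/2) \<cdot>\<^sub>v y = (1/2) \<cdot>\<^sub>v z" "m - (1/2) \<cdot>\<^sub>v z = (1/2) \<cdot>\<^sub>v y"
          unfolding m_def using bd[OF y] bd[OF z(1)] by (auto intro!: eq_vecI simp: field_simps)
        then have "face_le ?K y m" "face_le ?K z m"
          unfolding face_le_def using half by (auto intro!: exI[of _ "1/2"])
        then have ym: "y = y $ ?N \<cdot>\<^sub>v direction n m" and zm: "z = z $ ?N \<cdot>\<^sub>v direction n m"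
          using face_le_soc_boundary_iff[OF n, of m] bd[OF m] yK zK by auto
        have "direction n z = (1 / z $ ?N) \<cdot>\<^sub>v (z $ ?N \<cdot>\<^sub>v direction n m)"
          unfolding direction_def[of n z] using zm by metis
        also have "\<dots> = direction n m" using z(2) by (simp add: smult_smult_assoc)
        finally have "y = y $ ?N \<cdot>\<^sub>v direction n z" using ym by simp
        then show ?thesis using face_le_soc_boundary_iff[OF n, of z y] bd[OF z(1)] yK by blast
      qed
      then show ?thesis using z(1) by blast
    next
      case False
      then have zero: "y = 0\<^sub>v n" if "y \<in> F" for y
        using soc_eq_zero[OF n] that F(1) by blast
      obtain z where z: "z \<in> F" using F(2) by blast
      have eq: "z - 1 \<cdot>\<^sub>v y = z" if "y \<in> F" for y
        using zero[OF that] zero[OF z] by simp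
      have "z - 1 \<cdot>\<^sub>v y \<in> ?K" if "y \<in> F" for y
        unfolding eq[OF that] using z F(1) by blast
      then have "face_le ?K y z" if "y \<in> F" for y
        unfolding face_le_def using that by (intro exI[of _ 1]) simp
      then show ?thesis using z by blast
    qed
  qed
qed

lemma infinite_subset_constant_or_inj:
  assumes "infinite T"
  shows "\<exists>S\<subseteq>T. infinite S \<and> ((\<forall>a\<in>S. \<forall>b\<in>S. f a = f b) \<or> inj_on f S)"
proof (cases "finite (f ` T)")
  case True
  obtain a where a: "a \<in> T" "infinite {t \<in> T. f t = f a}"
    using pigeonhole_infinite[OF assms True] by blast
  then show ?thesis by (intro exI[of _ "{t \<in> T. f t = f a}"]) auto
next
  case False
  obtain S where S: "S \<subseteq> T" "inj_on f S" "f ` T = f ` S"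
    using subset_image_inj[of "f ` T" f T] by auto
  then have "infinite S" using False by auto
  then show ?thesis using S by blast
qed

text \<open>
  Infinitely many of the given points are interior, or infinitely many are on the boundary. In the
  latter case infinitely many have the same direction, or infinitely many have pairwise different
  directions, and rays in different directions meet only in \<open>0\<close>.
\<close>
lemma pairs_decide_faces_soc:
  assumes n: "n \<ge> 1"
  shows "pairs_decide_faces (second_order_cone n)"
  unfolding pairs_decide_faces_def
proof (intro allI impI)
  let ?K = "second_order_cone n" and ?N = "n - 1"
  fix T :: "real set" and z :: "real \<Rightarrow> real vec"
  assume T: "infinite T" and z: "z ` T \<subseteq> ?K"
  define I where "I = {t \<in> T. head_norm n (z t) < z t $ ?N}"
  show "\<exists>S\<subseteq>T. infinite S \<and> (\<forall>a\<in>S. \<forall>b\<in>S. \<forall>c\<in>S. a \<noteq> b \<longrightarrow>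
     (\<forall>y\<in>?K. face_le ?K y (z a) \<longrightarrow> face_le ?K y (z b) \<longrightarrow> face_le ?K y (z c)))"
  proof (cases "finite I")
    case False
    have "face_le ?K y (z c)" if "c \<in> I" "y \<in> ?K" for c y
      using face_le_soc_interior[OF n, of "z c" y] that z unfolding I_def by (auto simp: soc_iff)
    then show ?thesis using False by (intro exI[of _ I]) (auto simp: I_def)
  next
    case True
    then have "infinite (T - I)" using T by simp
    then obtain S where S: "S \<subseteq> T - I" "infinite S"
      and alt: "(\<forall>a\<in>S. \<forall>b\<in>S. direction n (z a) = direction n (z b)) \<or>
                inj_on (\<lambda>t. direction n (z t)) S"
      using infinite_subset_constant_or_inj[of "T - I" "\<lambda>t. direction n (z t)"] by blast
    have iff: "face_le ?K y (z t) \<longleftrightarrow> y = y $ ?N \<cdot>\<^sub>v direction n (z t)"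
      if "t \<in> S" "y \<in> ?K" for t y
    proof -
      have "z t \<in> ?K" "\<not> head_norm n (z t) < z t $ ?N" using that S(1) z unfolding I_def by auto
      then show ?thesis
        using face_le_soc_boundary_iff[OF n _ _ that(2), of "z t"] by (auto simp: soc_iff)
    qed
    have "face_le ?K y (z c)"
      if abc: "a \<in> S" "b \<in> S" "c \<in> S" "a \<noteq> b" and y: "y \<in> ?K"
        and le: "face_le ?K y (z a)" "face_le ?K y (z b)" for a b c y
    proof -
      have ya: "y = y $ ?N \<cdot>\<^sub>v direction n (z a)" and yb: "y = y $ ?N \<cdot>\<^sub>v direction n (z b)"
        using le iff abc y by blast+
      show ?thesis using alt
      proof
        assume "\<forall>a\<in>S. \<forall>b\<in>S. direction n (z a) = direction n (z b)"
        then show ?thesis using iff[OF abc(3) y] ya abc by metis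
      next
        assume inj: "inj_on (\<lambda>t. direction n (z t)) S"
        have "y $ ?N = 0"
        proof (rule ccontr)
          assume nz: "y $ ?N \<noteq> 0"
          have "direction n (z t) = (1 / y $ ?N) \<cdot>\<^sub>v (y $ ?N \<cdot>\<^sub>v direction n (z t))" for t
            using nz by (simp add: smult_smult_assoc)
          then have "direction n (z a) = direction n (z b)" using ya yb by metis
          then show False using inj abc by (auto simp: inj_on_def)
        qed
        moreover have "z c \<in> ?K" using abc(3) S(1) z by blast
        then have "dim_vec (z c) = n" by (simp add: soc_iff)
        ultimately have "y = y $ ?N \<cdot>\<^sub>v direction n (z c)"
          using soc_eq_zero[OF n y] by (auto simp: direction_def)
        then show ?thesis using iff[OF abc(3) y] by blast
      qed
    qed
    then show ?thesis using S by (intro exI[of _ S]) blast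
  qed
qed

lemma soc_product_properties:
  assumes "\<forall>l\<in>set ns. l \<ge> 1"
  shows "convex_cone (sum_list ns) (soc_product ns) \<and> has_generic_points (soc_product ns)
    \<and> pairs_decide_faces (soc_product ns)"
  using assms
proof (induction ns)
  case Nil
  have all: "face_le (carrier_vec 0) y z" if "z \<in> carrier_vec 0" "y \<in> carrier_vec 0" for y z :: "real vec"
    unfolding face_le_def using that by (intro exI[of _ 1]) auto
  have "convex_cone 0 (carrier_vec 0)" unfolding convex_cone_def by auto
  moreover have "has_generic_points (carrier_vec 0)"
    unfolding has_generic_points_def using all by blast
  moreover have "pairs_decide_faces (carrier_vec 0)"
    unfolding pairs_decide_faces_def using all by blast
  ultimately show ?case by simp
next
  case (Cons n ns)
  have eq: "soc_product (n # ns) = cone_prod (second_order_cone n) (soc_product ns)"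
    by (simp add: cone_prod_def)
  have n: "n \<ge> 1" using Cons.prems by simp
  have IH: "convex_cone (sum_list ns) (soc_product ns)" "has_generic_points (soc_product ns)"
    "pairs_decide_faces (soc_product ns)" using Cons by auto
  show ?case unfolding eq
    using convex_cone_cone_prod[OF convex_cone_soc[OF n] IH(1)]
      has_generic_points_cone_prod[OF convex_cone_soc[OF n] IH(1) has_generic_points_soc[OF n] IH(2)]
      pairs_decide_faces_cone_prod[OF convex_cone_soc[OF n] IH(1) pairs_decide_faces_soc[OF n] IH(3)]
    by simp
qed

section \<open>An obstruction to SOCP representability\<close>

text \<open>
  The hypothesis \<open>touch\<close> is a form of \<open>2\<close>-neighborliness of the polar set: any two of the points
  \<open>w t\<close> lie on a common face that avoids a given third one.
\<close>
lemma not_socp_representable_if_neighborly: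
  fixes T :: "real set" and w :: "real \<Rightarrow> real vec"
  assumes T: "infinite T" and w: "\<And>t. t \<in> T \<Longrightarrow> w t \<in> carrier_vec n"
    and valid: "\<And>t x. t \<in> T \<Longrightarrow> x \<in> \<Omega> \<Longrightarrow> w t \<bullet> x \<le> 1"
    and touch: "\<And>a b c. a \<in> T \<Longrightarrow> b \<in> T \<Longrightarrow> c \<in> T \<Longrightarrow> a \<noteq> b \<Longrightarrow> c \<noteq> a \<Longrightarrow> c \<noteq> b \<Longrightarrow>
       \<exists>x\<in>\<Omega>. w a \<bullet> x = 1 \<and> w b \<bullet> x = 1 \<and> w c \<bullet> x < 1"
  shows "\<not> socp_representable n \<Omega>"
proof
  assume "socp_representable n \<Omega>"
  then obtain k m ns A B b where ns: "\<forall>l\<in>set ns. l \<ge> 1" "sum_list ns = m"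
    and A: "A \<in> carrier_mat m n" and B: "B \<in> carrier_mat m k" and b: "b \<in> carrier_vec m"
    and Om: "\<Omega> = {x \<in> carrier_vec n. \<exists>u \<in> carrier_vec k. A *\<^sub>v x + B *\<^sub>v u + b \<in> soc_product ns}"
    unfolding socp_representable_def by blast
  let ?K = "soc_product ns"
  have K: "convex_cone m ?K" "has_generic_points ?K" "pairs_decide_faces ?K"
    using soc_product_properties[OF ns(1)] ns(2) by auto
  define G where "G x u = A *\<^sub>v x + B *\<^sub>v u + b" for x u
  have Gc: "G x u \<in> carrier_vec m" for x u
    using b unfolding G_def by (intro carrier_vecI) simp
  have aff: "G (r \<cdot>\<^sub>v x + (1 - r) \<cdot>\<^sub>v x') (r \<cdot>\<^sub>v u + (1 - r) \<cdot>\<^sub>v u')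
      = r \<cdot>\<^sub>v G x u + (1 - r) \<cdot>\<^sub>v G x' u'"
    if "x \<in> carrier_vec n" "x' \<in> carrier_vec n" "u \<in> carrier_vec k" "u' \<in> carrier_vec k"
    for r x x' u u'
  proof -
    have "A *\<^sub>v (r \<cdot>\<^sub>v x + (1 - r) \<cdot>\<^sub>v x') = r \<cdot>\<^sub>v (A *\<^sub>v x) + (1 - r) \<cdot>\<^sub>v (A *\<^sub>v x')"
      using that A by (simp add: mult_add_distrib_mat_vec[OF A] mult_mat_vec[OF A])
    moreover have "B *\<^sub>v (r \<cdot>\<^sub>v u + (1 - r) \<cdot>\<^sub>v u') = r \<cdot>\<^sub>v (B *\<^sub>v u) + (1 - r) \<cdot>\<^sub>v (B *\<^sub>v u')"
      using that B by (simp add: mult_add_distrib_mat_vec[OF B] mult_mat_vec[OF B])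
    ultimately show ?thesis unfolding G_def
      using that A B b by (intro eq_vecI) (auto simp: algebra_simps simp del: index_mult_mat_vec)
  qed
  have waff: "w t \<bullet> (r \<cdot>\<^sub>v x + s \<cdot>\<^sub>v x') = r * (w t \<bullet> x) + s * (w t \<bullet> x')"
    if "t \<in> T" "x \<in> carrier_vec n" "x' \<in> carrier_vec n" for t r s x x'
    using that w[OF that(1)] by (simp add: scalar_prod_add_distrib[of _ n])
  have lift: "\<exists>u\<in>carrier_vec k. G x u \<in> ?K" "x \<in> carrier_vec n" if "x \<in> \<Omega>" for x
    using that unfolding Om G_def by auto
  have project: "x \<in> \<Omega>" if "x \<in> carrier_vec n" "u \<in> carrier_vec k" "G x u \<in> ?K" for x u
    using that unfolding Om G_def by blast
  define F where "F t = {G x u | x u. x \<in> carrier_vec n \<and> u \<in> carrier_vec k \<and> G x u \<in> ?K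
      \<and> w t \<bullet> x = 1}" for t
  have F_I: "G x u \<in> F t" if "x \<in> carrier_vec n" "u \<in> carrier_vec k" "G x u \<in> ?K" "w t \<bullet> x = 1"
    for x u t using that unfolding F_def by blast
  have F_K: "F t \<subseteq> ?K" for t unfolding F_def by blast
  have "\<exists>z\<in>F t. \<forall>y\<in>F t. face_le ?K y z" if t: "t \<in> T" for t
  proof -
    note F_K[of t]
    moreover have "F t \<noteq> {}"
    proof -
      have "infinite (T - {t})" using T by simp
      then obtain p where p: "p \<in> T" "p \<noteq> t" using infinite_imp_nonempty by blast
      have "infinite (T - {t, p})" using T by simp
      then obtain q where q: "q \<in> T" "q \<noteq> t" "q \<noteq> p" using infinite_imp_nonempty by blast
      then obtain x where "x \<in> \<Omega>" "w t \<bullet> x = 1" using touch[OF t p(1) q(1)] p by metis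
      then show ?thesis using lift unfolding F_def by blast
    qed
    moreover have "midpoint_closed (F t)"
      unfolding midpoint_closed_def
    proof (intro ballI)
      fix y y' assume "y \<in> F t" "y' \<in> F t"
      then obtain x u x' u' where s: "y = G x u" "y' = G x' u'" "x \<in> carrier_vec n"
        "x' \<in> carrier_vec n" "u \<in> carrier_vec k" "u' \<in> carrier_vec k" "y \<in> ?K" "y' \<in> ?K"
        "w t \<bullet> x = 1" "w t \<bullet> x' = 1" unfolding F_def by blast
      let ?x = "(1/2) \<cdot>\<^sub>v x + (1 - 1/2) \<cdot>\<^sub>v x'" and ?u = "(1/2) \<cdot>\<^sub>v u + (1 - 1/2) \<cdot>\<^sub>v u'"
      have "(1/2) \<cdot>\<^sub>v (y + y') = G ?x ?u"
        unfolding aff[OF s(3-6)] s(1,2) using Gc by (subst smult_add_distrib_vec[of _ m]) auto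
      moreover have "(1/2) \<cdot>\<^sub>v (y + y') \<in> ?K"
        by (rule convex_cone_smult[OF K(1) convex_cone_add[OF K(1) s(7,8)]]) simp
      moreover have "w t \<bullet> ?x = 1" unfolding waff[OF t s(3,4)] using s by simp
      moreover have "?x \<in> carrier_vec n" "?u \<in> carrier_vec k" using s by auto
      ultimately show "(1/2) \<cdot>\<^sub>v (y + y') \<in> F t" using F_I by metis
    qed
    ultimately show ?thesis using K(2) unfolding has_generic_points_def by blast
  qed
  then have "\<forall>t\<in>T. \<exists>z. z \<in> F t \<and> (\<forall>y\<in>F t. face_le ?K y z)" by blast
  from bchoice[OF this] obtain z where z: "\<And>t. t \<in> T \<Longrightarrow> z t \<in> F t"
    and dom: "\<And>t y. t \<in> T \<Longrightarrow> y \<in> F t \<Longrightarrow> face_le ?K y (z t)" by blast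
  have "z ` T \<subseteq> ?K" using subsetD[OF F_K z] by (rule image_subsetI)
  then obtain S where S: "S \<subseteq> T" "infinite S" and
    dec: "\<And>a b c y. a \<in> S \<Longrightarrow> b \<in> S \<Longrightarrow> c \<in> S \<Longrightarrow> a \<noteq> b \<Longrightarrow> y \<in> ?K \<Longrightarrow>
       face_le ?K y (z a) \<Longrightarrow> face_le ?K y (z b) \<Longrightarrow> face_le ?K y (z c)"
    using K(3) T unfolding pairs_decide_faces_def by meson
  obtain R where "R \<subseteq> S" "finite R" "card R = 3"
    using infinite_arbitrarily_large[OF S(2)] by metis
  then obtain p q c where pqc: "p \<in> S" "q \<in> S" "c \<in> S" "p \<noteq> q" "c \<noteq> p" "c \<noteq> q"
    by (auto simp: card_3_iff)
  then have inT: "p \<in> T" "q \<in> T" "c \<in> T" using S(1) by auto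
  obtain x where x: "x \<in> \<Omega>" "w p \<bullet> x = 1" "w q \<bullet> x = 1" "w c \<bullet> x < 1"
    using touch[OF inT pqc(4-6)] by blast
  obtain u where xu: "x \<in> carrier_vec n" "u \<in> carrier_vec k" "G x u \<in> ?K"
    using lift[OF x(1)] by blast
  then have "G x u \<in> F p" "G x u \<in> F q" using x unfolding F_def by blast+
  then have "face_le ?K (G x u) (z c)"
    using dec[OF pqc(1-4) xu(3)] dom inT by blast
  then obtain e where e: "e > 0" "z c - e \<cdot>\<^sub>v G x u \<in> ?K" unfolding face_le_def by blast
  obtain x' u' where s: "z c = G x' u'" "x' \<in> carrier_vec n" "u' \<in> carrier_vec k"
    "w c \<bullet> x' = 1" using z[OF inT(3)] unfolding F_def by auto
  have zK: "z c \<in> ?K" using z[OF inT(3)] F_K by blast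
  \<comment> \<open>A step length below \<open>1\<close> makes \<open>z c - d y\<close>, where \<open>y = G x u\<close>, a positive multiple of a point on the line through
    \<open>y\<close> and \<open>z c\<close>, namely the one with weights \<open>r < 0\<close> and \<open>1 - r\<close>.\<close>
  define d where "d = min e (1/2)"
  have d: "0 < d" "d < 1" using e unfolding d_def by auto
  have zd: "z c - d \<cdot>\<^sub>v G x u \<in> ?K"
    by (rule convex_cone_diff_smult_smaller[OF K(1) zK Gc e(2)]) (use d in \<open>auto simp: d_def\<close>)
  define h where "h = 1 / (1 - d)"
  define r where "r = - (h * d)"
  have h: "h > 0" and r: "r < 0" using d unfolding r_def h_def by simp_all
  have r1: "1 - r = h" using d unfolding r_def h_def by (simp add: field_simps)
  let ?x = "r \<cdot>\<^sub>v x + (1 - r) \<cdot>\<^sub>v x'" and ?u = "r \<cdot>\<^sub>v u + (1 - r) \<cdot>\<^sub>v u'"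
  have "G ?x ?u = r \<cdot>\<^sub>v G x u + (1 - r) \<cdot>\<^sub>v z c"
    unfolding aff[OF xu(1) s(2) xu(2) s(3)] s(1) ..
  also have "\<dots> = h \<cdot>\<^sub>v (z c - d \<cdot>\<^sub>v G x u)"
    unfolding r1 unfolding r_def s(1) using Gc[of x u] Gc[of x' u']
    by (intro eq_vecI) (auto simp: algebra_simps)
  also have "\<dots> \<in> ?K" using convex_cone_smult[OF K(1) zd] h by simp
  finally have "?x \<in> \<Omega>" using project[of ?x ?u] xu s by auto
  then have "w c \<bullet> ?x \<le> 1" using valid[OF inT(3)] by blast
  then have "r * (w c \<bullet> x) + (1 - r) \<le> 1" using waff[OF inT(3) xu(1) s(2), of r "1 - r"] s(4) by simp
  moreover have "0 < r * (w c \<bullet> x - 1)" using r x(4) by (intro mult_neg_neg) auto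
  ultimately show False by (simp add: algebra_simps)
qed

section \<open>Polynomials bounded by one on an interval\<close>

definition moment_vec :: "nat \<Rightarrow> real \<Rightarrow> real vec" where
  "moment_vec n t = vec n (\<lambda>i. t ^ i)"

text \<open>
  A vector \<open>x\<close> stands for the polynomial with coefficients \<open>x\<^sub>0, \<dots>, x\<^sub>n\<^sub>-\<^sub>1\<close>, whose value at \<open>t\<close> is
  \<open>moment_vec n t \<bullet> x\<close>.
\<close>
definition bounded_polys :: "nat \<Rightarrow> real vec set" where
  "bounded_polys n = {x \<in> carrier_vec n. \<forall>t\<in>{-1..1}. (moment_vec n t \<bullet> x)\<^sup>2 \<le> 1}"

lemma moment_vec_carrier [simp]: "moment_vec n t \<in> carrier_vec n"
  unfolding moment_vec_def by simp

lemma moment_vec_prod_coeffs: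
  assumes "degree p < n"
  shows "moment_vec n t \<bullet> vec n (coeff p) = poly p t"
proof -
  have "poly p t = (\<Sum>i\<in>{0..<n}. coeff p i * t ^ i)"
    unfolding poly_altdef using assms
    by (intro sum.mono_neutral_left) (auto intro: coeff_eq_0)
  then show ?thesis unfolding scalar_prod_def moment_vec_def by (simp add: mult.commute)
qed

lemma moment_vec_annihilator:
  assumes x: "x \<in> carrier_vec n" and zero: "\<forall>t\<in>{-1..1}. moment_vec n t \<bullet> x = 0"
  shows "x = 0\<^sub>v n"
proof -
  define p where "p = (\<Sum>i<n. monom (x $ i) i)"
  have "poly p t = moment_vec n t \<bullet> x" for t
    using x unfolding p_def moment_vec_def scalar_prod_def
    by (auto simp: poly_sum poly_monom atLeast0LessThan mult.commute)
  then have "{-1..1} \<subseteq> {t. poly p t = 0}" using zero by auto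
  then have "infinite {t. poly p t = 0}"
    by (rule infinite_super) (simp add: infinite_Icc)
  then have "p = 0" using poly_roots_finite by blast
  moreover have "coeff p i = x $ i" if "i < n" for i
    unfolding p_def coeff_sum using that by simp
  ultimately have "x $ i = 0" if "i < n" for i
    using that by (metis coeff_0)
  then show ?thesis using x by (intro eq_vecI) auto
qed

text \<open>
  The matrix \<open>P(t)\<close> with entries \<open>t\<^bsup>i+j\<^esup>\<close> has rank one, and its quadratic form is the square of the
  value at \<open>t\<close>. The common kernel is trivial since a polynomial vanishing on \<open>[-1, 1]\<close> is zero.
\<close>
lemma generalized_ellipsoid_bounded_polys:
  "generalized_ellipsoid n (2 * (n - 1)) (bounded_polys n)"
proof -
  define P :: "real poly mat" where "P = mat n n (\<lambda>(i, j). monom 1 (i + j))"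
  have ev: "eval_mat P t = mat n n (\<lambda>(i, j). t ^ (i + j))" for t
    unfolding eval_mat_def P_def by (intro eq_matI) (auto simp: poly_monom)
  have mv: "eval_mat P t *\<^sub>v x = (moment_vec n t \<bullet> x) \<cdot>\<^sub>v moment_vec n t"
    if "x \<in> carrier_vec n" for x t
    using that unfolding ev moment_vec_def
    by (intro eq_vecI) (auto simp: scalar_prod_def sum_distrib_left power_add mult_ac)
  have quad: "x \<bullet> (eval_mat P t *\<^sub>v x) = (moment_vec n t \<bullet> x)\<^sup>2" if x: "x \<in> carrier_vec n" for x t
    unfolding mv[OF x] using x by (simp add: power2_eq_square comm_scalar_prod[of x n])
  have sym: "poly_sym_mat n (2 * (n - 1)) P"
    unfolding poly_sym_mat_def P_def
    by (auto simp: degree_monom_eq add.commute intro!: eq_matI)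
  have psd: "psd_mat n (eval_mat P t)" for t
  proof -
    have "(eval_mat P t)\<^sup>T = eval_mat P t" "eval_mat P t \<in> carrier_mat n n"
      unfolding ev by (auto simp: add.commute intro!: eq_matI)
    then show ?thesis unfolding psd_mat_def using quad by auto
  qed
  have "v = 0\<^sub>v n" if v: "\<forall>t\<in>{-1..1}. v \<in> mat_kernel (eval_mat P t)" for v
  proof -
    have v': "v \<in> carrier_vec n" "eval_mat P t *\<^sub>v v = 0\<^sub>v n" if "t \<in> {-1..1}" for t
      using v that unfolding mat_kernel_def by (auto simp: ev)
    have vc: "v \<in> carrier_vec n" using v'(1)[of 0] by simp
    have "(moment_vec n t \<bullet> v)\<^sup>2 = 0" if "t \<in> {-1..1}" for t
      using quad[OF vc, of t] v'(2)[OF that] vc by simp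
    then show ?thesis using moment_vec_annihilator[OF vc] by simp
  qed
  moreover have "0\<^sub>v n \<in> mat_kernel (eval_mat P t)" for t
    unfolding mat_kernel_def by (auto simp: ev intro!: eq_vecI)
  ultimately have ker: "(\<Inter>t\<in>{-1..1}. mat_kernel (eval_mat P t)) = {0\<^sub>v n}" by auto
  have "bounded_polys n = {x \<in> carrier_vec n.
      \<forall>t\<in>{-1..1}. (x - 0\<^sub>v n) \<bullet> (eval_mat P t *\<^sub>v (x - 0\<^sub>v n)) \<le> 1}"
    unfolding bounded_polys_def using quad by auto
  then show ?thesis
    unfolding generalized_ellipsoid_def using sym psd ker zero_carrier_vec by blast
qed

text \<open>
  The bound \<open>5\<close> leaves room for the quartic \<open>(t - a)\<^sup>2 (t - b)\<^sup>2\<close>. The factor \<open>1/16\<close> scales it into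
  \<open>[0, 1]\<close>, as each of the distances \<open>|t - a|\<close> and \<open>|t - b|\<close> is at most \<open>2\<close> on \<open>[-1, 1]\<close>.
\<close>
lemma not_socp_representable_bounded_polys:
  assumes "n \<ge> 5"
  shows "\<not> socp_representable n (bounded_polys n)"
proof (rule not_socp_representable_if_neighborly[where T = "{-1..1}" and w = "moment_vec n"])
  show "infinite {-1..1::real}" by (simp add: infinite_Icc)
  show "moment_vec n t \<in> carrier_vec n" for t by simp
  show "moment_vec n t \<bullet> x \<le> 1" if "t \<in> {-1..1}" "x \<in> bounded_polys n" for t x
    using that unfolding bounded_polys_def by (fastforce simp: abs_square_le_1 abs_le_iff)
  fix a b c :: real
  assume abc: "a \<in> {-1..1}" "b \<in> {-1..1}" "c \<in> {-1..1}" "a \<noteq> b" "c \<noteq> a" "c \<noteq> b"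
  define p :: "real poly" where "p = [:1:] - Polynomial.smult (1/16) ([:-a, 1:]\<^sup>2 * [:-b, 1:]\<^sup>2)"
  have pt: "poly p t = 1 - ((t - a) * (t - b))\<^sup>2 / 16" for t
    unfolding p_def by (simp add: power_mult_distrib)
  have "degree ([:-a, 1:]\<^sup>2 * [:-b, 1:]\<^sup>2) \<le> 4"
    using degree_mult_le[of "[:-a, 1:]\<^sup>2" "[:-b, 1:]\<^sup>2"]
      degree_power_le[of "[:-a, 1:]" 2] degree_power_le[of "[:-b, 1:]" 2] by simp
  then have "degree p \<le> 4"
    unfolding p_def by (intro degree_diff_le) (auto intro: order_trans[OF degree_smult_le])
  then have deg: "degree p < n" using assms by simp
  have "(poly p t)\<^sup>2 \<le> 1" if t: "t \<in> {-1..1}" for t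
  proof -
    have "\<bar>(t - a) * (t - b)\<bar> \<le> 2 * 2"
      unfolding abs_mult using t abc by (intro mult_mono) auto
    then have "((t - a) * (t - b))\<^sup>2 \<le> 4\<^sup>2" by (intro abs_le_square_iff[THEN iffD1]) simp
    then show ?thesis unfolding pt abs_square_le_1 by (simp add: abs_le_iff)
  qed
  then have "vec n (coeff p) \<in> bounded_polys n"
    unfolding bounded_polys_def by (simp add: moment_vec_prod_coeffs[OF deg])
  then show "\<exists>x\<in>bounded_polys n. moment_vec n a \<bullet> x = 1 \<and> moment_vec n b \<bullet> x = 1 \<and>
      moment_vec n c \<bullet> x < 1"
    using abc by (intro bexI[of _ "vec n (coeff p)"]) (auto simp: moment_vec_prod_coeffs[OF deg] pt)
qed

theorem theorem4p2:
  shows "\<exists>E. generalized_ellipsoid 9 16 E \<and> \<not> socp_representable 9 E"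
  using generalized_ellipsoid_bounded_polys[of 9] not_socp_representable_bounded_polys[of 9] by auto

end
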